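(* Over the space $\mathcal{S}$ of star-shaped regions centered at the origin, the topology generated by the symmetric-difference metric $V$ is not finer than the topology generated by the Hausdorff metric $H$; and for every Mulholland function $\psi$, the topology generated by the Wasserstein metric $W^\psi$ is not finer than the topology generated by $H$.
   Context: Fix $n\ge 2$; $\mathbb{E}^n$ is $n$-dimensional Euclidean space with distance $d$ and a chosen origin; $v$ is $n$-dimensional volume. A region is a nonempty bounded open subset of $\mathbb{E}^n$ equal to the interior of its closure. $\mathcal{S}$ is the set of all regions that are star-shaped with respect to the origin. "Finer" is meant in the non-strict sense (finer than or equal to); "not finer" is its negation. For a point $p$ and region $Q$, $d(p,Q)=\min_{q\in\bar Q}d(p,q)$; $H^1(P,Q)=\sup_{p\in P}d(p,Q)$; the Hausdorff metric is $H(P,Q)=\max(H^1(P,Q),H^1(Q,P))$. The symmetric-difference metric is $V(P,Q)=v((P\setminus Q)\cup(Q\setminus P))$. Mulholland function: a continuous, (strictly) increasing $\psi:\mathbb{R}^{\ge0}\to\mathbb{R}^{\ge0}$ with $\psi(0)=0$, $\lim_{x\to\infty}\psi(x)=\infty$, and $\psi^{-1}(\sum_{i=1}^m\psi(x_i+y_i))\le\psi^{-1}(\sum_{i=1}^m\psi(x_i))+\psi^{-1}(\sum_{i=1}^m\psi(y_i))$ for all $m$ and all $x_i,y_i\ge0$. Wasserstein metric: for a region $P$ let $U_P$ be the uniform probability distribution on $P$. For regions $P,Q$, $W^\psi(P,Q)=\inf_\gamma\psi^{-1}\left(\frac{1}{v(P)}\int_P\psi(d(x,\gamma(x)))\,dx\right)$,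 the infimum over all (measurable) functions $\gamma$ such that if a random variable $X$ has distribution $U_P$ then $\gamma(X)$ has distribution $U_Q$. *)

theory Defs
  imports "HOL-Probability.Probability"
begin

definition region :: "'a::euclidean_space set \<Rightarrow> bool" where
  "region P \<longleftrightarrow> P \<noteq> {} \<and> bounded P \<and> open P \<and> interior (closure P) = P"

definition star_regions :: "'a::euclidean_space set set" where
  "star_regions = {P. region P \<and> (\<forall>x\<in>P. closed_segment 0 x \<subseteq> P)}"

text \<open>
  The topology generated by a distance function, given by its open sets. It is stated for an
  arbitrary function \<open>d\<close> so that it can be unfolded without first showing that \<open>d\<close> is a metric on
  \<open>M\<close>; the lemma \<open>dist_topology_eq_mtopology\<close> identifies it with the metric topology of the library.
\<close>
definition dist_topology :: "'b set \<Rightarrow> ('b \<Rightarrow> 'b \<Rightarrow> real) \<Rightarrow> 'b topology" where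
  "dist_topology M d =
     topology (\<lambda>U. U \<subseteq> M \<and> (\<forall>x\<in>U. \<exists>r>0. \<forall>y\<in>M. d x y < r \<longrightarrow> y \<in> U))"

lemma openin_dist_topology:
  "openin (dist_topology M d) U \<longleftrightarrow>
     U \<subseteq> M \<and> (\<forall>x\<in>U. \<exists>r>0. \<forall>y\<in>M. d x y < r \<longrightarrow> y \<in> U)"
proof -
  let ?op = "\<lambda>U. U \<subseteq> M \<and> (\<forall>x\<in>U. \<exists>r>0. \<forall>y\<in>M. d x y < r \<longrightarrow> y \<in> U)"
  have "?op (S \<inter> T)" if S: "?op S" and T: "?op T" for S T
  proof (intro conjI ballI)
    show "S \<inter> T \<subseteq> M" using S by blast
    fix x assume x: "x \<in> S \<inter> T"
    obtain r where "r > 0" "\<forall>y\<in>M. d x y < r \<longrightarrow> y \<in> S" using S x by blast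
    moreover obtain s where "s > 0" "\<forall>y\<in>M. d x y < s \<longrightarrow> y \<in> T" using T x by blast
    ultimately show "\<exists>r>0. \<forall>y\<in>M. d x y < r \<longrightarrow> y \<in> S \<inter> T"
      by (intro exI[of _ "min r s"]) auto
  qed
  moreover have "?op (\<Union>K)" if K: "\<forall>S\<in>K. ?op S" for K
  proof (intro conjI ballI)
    show "\<Union>K \<subseteq> M" using K by blast
    fix x assume "x \<in> \<Union>K"
    then obtain S where "S \<in> K" "x \<in> S" by blast
    then obtain r where "r > 0" "\<forall>y\<in>M. d x y < r \<longrightarrow> y \<in> S" using K by blast
    then show "\<exists>r>0. \<forall>y\<in>M. d x y < r \<longrightarrow> y \<in> \<Union>K" using \<open>S \<in> K\<close> by blast
  qed
  ultimately have "istopology ?op" unfolding istopology_def by blast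
  then show ?thesis unfolding dist_topology_def by (simp add: topology_inverse')
qed

lemma topspace_dist_topology [simp]: "topspace (dist_topology M d) = M"
proof (rule antisym)
  show "topspace (dist_topology M d) \<subseteq> M"
    using openin_topspace[of "dist_topology M d"] unfolding openin_dist_topology by (rule conjunct1)
  have "openin (dist_topology M d) M"
    by (auto simp: openin_dist_topology intro: exI[of _ "1::real"])
  then show "M \<subseteq> topspace (dist_topology M d)" by (rule openin_subset)
qed

lemma dist_topology_eq_mtopology:
  assumes "Metric_space M d"
  shows "dist_topology M d = Metric_space.mtopology M d"
proof -
  interpret Metric_space M d by fact
  have "(\<forall>y\<in>M. d x y < r \<longrightarrow> y \<in> U) \<longleftrightarrow> mball x r \<subseteq> U" if "x \<in> M" for x r U
    using that by (auto simp: mball_def)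
  then have "openin (dist_topology M d) U \<longleftrightarrow> openin mtopology U" for U
    unfolding openin_dist_topology openin_mtopology by (metis subsetD)
  then show ?thesis by (simp add: topology_eq)
qed

text \<open>Non-strict: \<open>X\<close> is finer than or equal to \<open>Y\<close>.\<close>
definition finer_topology :: "'b topology \<Rightarrow> 'b topology \<Rightarrow> bool" where
  "finer_topology X Y \<longleftrightarrow> (\<forall>U. openin Y U \<longrightarrow> openin X U)"

text \<open>
  Since \<open>closure Q\<close> is compact and nonempty for a region \<open>Q\<close>, the infimum in \<^const>\<open>infdist\<close>
  is a minimum.
\<close>
definition hausdorff1 :: "'a::euclidean_space set \<Rightarrow> 'a set \<Rightarrow> real" where
  "hausdorff1 P Q = (SUP p\<in>P. infdist p (closure Q))"

definition hausdorff_metric :: "'a::euclidean_space set \<Rightarrow> 'a set \<Rightarrow> real" where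
  "hausdorff_metric P Q = max (hausdorff1 P Q) (hausdorff1 Q P)"

definition symdiff_metric :: "'a::euclidean_space set \<Rightarrow> 'a set \<Rightarrow> real" where
  "symdiff_metric P Q = measure lborel ((P - Q) \<union> (Q - P))"

text \<open>
  Functions on the nonnegative reals are represented by total functions on the reals, of which
  only the restriction to \<open>{0..}\<close> matters; accordingly the inverse is taken on \<open>{0..}\<close>.
\<close>
definition nonneg_inv :: "(real \<Rightarrow> real) \<Rightarrow> real \<Rightarrow> real" where
  "nonneg_inv \<psi> = inv_into {0..} \<psi>"

definition mulholland :: "(real \<Rightarrow> real) \<Rightarrow> bool" where
  "mulholland \<psi> \<longleftrightarrow>
     \<psi> ` {0..} \<subseteq> {0..} \<and> continuous_on {0..} \<psi> \<and> strict_mono_on {0..} \<psi> \<and> \<psi> 0 = 0 \<and>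
     filterlim \<psi> at_top at_top \<and>
     (\<forall>(m::nat) (x::nat \<Rightarrow> real) (y::nat \<Rightarrow> real).
        (\<forall>i\<in>{1..m}. 0 \<le> x i \<and> 0 \<le> y i) \<longrightarrow>
        nonneg_inv \<psi> (\<Sum>i=1..m. \<psi> (x i + y i))
          \<le> nonneg_inv \<psi> (\<Sum>i=1..m. \<psi> (x i)) + nonneg_inv \<psi> (\<Sum>i=1..m. \<psi> (y i)))"

text \<open>
  The maps \<open>\<gamma>\<close> that push the uniform distribution on \<open>P\<close> forward to the uniform distribution on \<open>Q\<close>.
  Values of \<open>\<gamma>\<close> outside \<open>P\<close> are irrelevant.
\<close>
definition transport_maps :: "'a::euclidean_space set \<Rightarrow> 'a set \<Rightarrow> ('a \<Rightarrow> 'a) set" where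
  "transport_maps P Q =
     {\<gamma> \<in> borel_measurable borel.
        distr (uniform_measure lborel P) lborel \<gamma> = uniform_measure lborel Q}"

text \<open>
  For regions \<open>P\<close> and \<open>Q\<close> a transport map \<open>\<gamma>\<close> sends almost every point of \<open>P\<close> into the bounded
  set \<open>Q\<close>, so the integrand is essentially bounded and hence integrable. The real-valued infimum is
  over a nonempty set, as any two atomless Borel probability measures on a Euclidean space are
  related by a measurable map.
\<close>
definition wasserstein_metric ::
    "(real \<Rightarrow> real) \<Rightarrow> 'a::euclidean_space set \<Rightarrow> 'a set \<Rightarrow> real" where
  "wasserstein_metric \<psi> P Q =
     (INF \<gamma>\<in>transport_maps P Q.
        nonneg_inv \<psi> (1 / measure lborel P * (LINT x:P|lborel. \<psi> (dist x (\<gamma> x)))))"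

end

theory Submission
  imports Defs
begin

text \<open>
  Cut a thin slab off the cube \<open>(-1, 1)\<^sup>n\<close> at its face \<open>x \<bullet> e = -1\<close>, \<open>e\<close> a basis vector, and reshape it,
  by a diagonal affine map of determinant one, into a needle attached to the opposite face and
  reaching \<open>x \<bullet> e = 2\<close>. A needle of radius \<open>\<delta>\<close> has volume \<open>(2\<delta>)\<^bsup>n-1\<^esup>\<close>, which tends to \<open>0\<close> since \<open>n \<ge> 2\<close>.
  The map that is the identity on the rest of the cube and the reshaping on the slab transports
  one uniform distribution to the other and moves only the slab, by a bounded distance. So the
  resulting regions converge to the cube with respect to \<open>V\<close> and \<open>W\<^sup>\<psi>\<close>, but they never
  enter the \<open>H\<close>-neighbourhood of the cube that consists of the regions bounded away from the
  half-space \<open>x \<bullet> e \<ge> 2\<close>.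
\<close>

section \<open>Star-shaped bodies and Lebesgue measure\<close>

text \<open>The interior of a closed set is regular open. For \<open>t > 0\<close> scaling by
  \<open>t\<close> is an open map, so it carries \<open>interior K\<close> to an open subset of
  \<open>K\<close>, hence into \<open>interior K\<close>; for \<open>t = 0\<close> the hypothesis on
  \<open>0\<close> takes over.\<close>

lemma interior_star_regions:
  fixes K :: "'a::euclidean_space set"
  assumes "closed K" "bounded K" and 0: "0 \<in> interior K"
    and star: "\<And>x t. x \<in> K \<Longrightarrow> 0 \<le> t \<Longrightarrow> t \<le> 1 \<Longrightarrow> t *\<^sub>R x \<in> K"
  shows "interior K \<in> star_regions"
proof -
  have "interior (closure (interior K)) \<subseteq> interior K"
    using \<open>closed K\<close> by (meson closure_minimal interior_mono interior_subset)
  moreover have "interior K \<subseteq> interior (closure (interior K))"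
    by (simp add: closure_subset interior_maximal)
  ultimately have "region (interior K)"
    using assms unfolding region_def by auto
  moreover have "closed_segment 0 x \<subseteq> interior K" if x: "x \<in> interior K" for x
  proof
    fix y assume "y \<in> closed_segment 0 x"
    then obtain t where t: "0 \<le> t" "t \<le> 1" and y: "y = t *\<^sub>R x"
      by (auto simp: in_segment)
    show "y \<in> interior K"
    proof (cases "t = 0")
      case True
      then show ?thesis using y 0 by simp
    next
      case False
      have "(\<lambda>z. t *\<^sub>R z) ` interior K \<subseteq> interior K"
      proof (rule interior_maximal)
        show "(\<lambda>z. t *\<^sub>R z) ` interior K \<subseteq> K"
          using star t interior_subset by blast
        show "open ((\<lambda>z. t *\<^sub>R z) ` interior K)"
          using False by (intro open_scaling) auto
      qed
      then show ?thesis using x y by blast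
    qed
  qed
  ultimately show ?thesis by (auto simp: star_regions_def)
qed

lemma AE_not_in_frontier_convex:
  fixes S :: "'a::euclidean_space set"
  assumes "convex S"
  shows "AE x in lborel. x \<notin> frontier S"
proof -
  have "frontier S \<in> null_sets lborel"
    using negligible_convex_frontier[OF assms]
    by (simp add: negligible_iff_null_sets null_sets_completion_iff borel_closed)
  then show ?thesis by (rule AE_not_in)
qed

text \<open>The product is the absolute determinant of the linear part, so the constant density in
  the affine change of variables is \<open>1\<close>.\<close>

lemma distr_diagonal_affine:
  fixes t :: "'a::euclidean_space"
  assumes "(\<Prod>j\<in>Basis. \<bar>c j\<bar>) = 1"
  shows "distr lborel borel (\<lambda>x. t + (\<Sum>j\<in>Basis. (c j * (x \<bullet> j)) *\<^sub>R j)) = lborel"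
proof -
  have "c j \<noteq> 0" if "j \<in> Basis" for j
    using assms that by (metis abs_zero finite_Basis prod_zero zero_neq_one)
  from lborel_affine_euclidean[of c t, OF this] show ?thesis
    using assms by (simp add: density_1)
qed

lemma measure_less_if_emeasure_less:
  assumes "emeasure M A < ennreal r"
  shows "measure M A < r"
proof -
  have "emeasure M A = ennreal (measure M A)"
    using assms by (intro emeasure_eq_ennreal_measure) auto
  then show ?thesis using assms by (simp add: ennreal_less_iff)
qed

lemma emeasure_vimage_preserving:
  assumes "T \<in> borel_measurable borel" "distr lborel borel T = lborel" "C \<in> sets borel"
  shows "emeasure lborel (T -` C) = emeasure lborel C"
  using assms emeasure_distr[of T lborel borel C] by simp

section \<open>Transport maps that move one piece, and their cost\<close>

text \<open>For Borel \<open>B\<close>, the points of \<open>P\<close> sent into \<open>B\<close>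
  are those of \<open>A \<inter> B\<close> and those that \<open>T\<close> sends into
  \<open>S \<inter> B\<close>. Since \<open>T\<close> preserves volume, both pieces together have
  the volume of \<open>Q \<inter> B\<close>. A null set of discrepancy is allowed because in the
  application \<open>Q\<close> also contains the face where the two pieces meet.\<close>

lemma exchange_in_transport_maps:
  assumes [measurable]: "A \<in> sets borel" "S \<in> sets borel" "Q \<in> sets borel"
    "T \<in> borel_measurable borel"
    and T: "distr lborel borel T = lborel"
    and disj: "A \<inter> T -` S = {}" "A \<inter> S = {}" and P: "P = A \<union> T -` S"
    and Q: "AE x in lborel. x \<in> Q \<longleftrightarrow> x \<in> A \<union> S"
  shows "(\<lambda>x. if x \<in> A then x else T x) \<in> transport_maps P Q"
proof -
  let ?g = "\<lambda>x. if x \<in> A then x else T x"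
  have g[measurable]: "?g \<in> borel_measurable borel" by measurable
  have TS: "T -` C \<in> sets borel" if "C \<in> sets borel" for C
    using measurable_sets[OF assms(4) that] by simp
  have Ps[measurable]: "P \<in> sets borel" using P TS by auto
  have eq: "emeasure lborel (P \<inter> ?g -` B) = emeasure lborel (Q \<inter> B)"
    if B[measurable]: "B \<in> sets borel" for B
  proof -
    have "P \<inter> ?g -` B = (A \<inter> B) \<union> T -` (S \<inter> B)"
      using P disj by (auto split: if_splits)
    moreover have "(A \<inter> B) \<inter> T -` (S \<inter> B) = {}" using disj by auto
    ultimately have "emeasure lborel (P \<inter> ?g -` B)
        = emeasure lborel (A \<inter> B) + emeasure lborel (T -` (S \<inter> B))"
      using TS[of "S \<inter> B"] by (simp add: plus_emeasure)
    also have "\<dots> = emeasure lborel (A \<inter> B) + emeasure lborel (S \<inter> B)"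
      using emeasure_vimage_preserving[OF assms(4) T, of "S \<inter> B"] by (simp del: vimage_Int)
    also have "\<dots> = emeasure lborel ((A \<inter> B) \<union> (S \<inter> B))"
      using disj by (intro plus_emeasure) auto
    also have "\<dots> = emeasure lborel (Q \<inter> B)"
      using Q by (intro emeasure_eq_AE) auto
    finally show ?thesis .
  qed
  \<comment> \<open>Both uniform distributions are therefore normalised by the same
    constant.\<close>
  have PQ: "emeasure lborel P = emeasure lborel Q" using eq[of UNIV] by simp
  have "distr (uniform_measure lborel P) lborel ?g = uniform_measure lborel Q"
  proof (rule measure_eqI)
    fix B assume "B \<in> sets (distr (uniform_measure lborel P) lborel ?g)"
    then have B[measurable]: "B \<in> sets borel" by simp
    have "?g -` B \<in> sets borel" using measurable_sets[OF g B] by simp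
    then show "emeasure (distr (uniform_measure lborel P) lborel ?g) B
        = emeasure (uniform_measure lborel Q) B"
      using eq[OF B] PQ by (simp add: emeasure_distr)
  qed simp
  then show ?thesis using g by (simp add: transport_maps_def)
qed

text \<open>The limit at infinity confines the search to a bounded interval, where the intermediate
  value theorem applies. Surjectivity makes \<open>nonneg_inv\<close> a genuine right inverse on the
  nonnegative reals.\<close>

lemma mulholland_surj:
  assumes "mulholland \<psi>" "0 \<le> y"
  obtains x where "0 \<le> x" "\<psi> x = y"
proof -
  have "filterlim \<psi> at_top at_top" using assms by (simp add: mulholland_def)
  then have "\<forall>\<^sub>F x in at_top. y \<le> \<psi> x" by (simp add: filterlim_at_top)
  then obtain N where N: "\<And>x. N \<le> x \<Longrightarrow> y \<le> \<psi> x" by (auto simp: eventually_at_top_linorder)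
  have "continuous_on {0..max 0 N} \<psi>" "\<psi> 0 = 0"
    using assms by (auto simp: mulholland_def intro: continuous_on_subset)
  then obtain x where "0 \<le> x" "\<psi> x = y"
    using IVT'[of \<psi> 0 y "max 0 N"] N[of "max 0 N"] assms(2) by auto
  then show ?thesis using that by blast
qed

lemma nonneg_inv_mulholland:
  assumes "mulholland \<psi>" "0 \<le> y"
  shows "0 \<le> nonneg_inv \<psi> y" "\<psi> (nonneg_inv \<psi> y) = y"
proof -
  have "y \<in> \<psi> ` {0..}" using mulholland_surj[OF assms] by (metis atLeast_iff imageI)
  then show "0 \<le> nonneg_inv \<psi> y" "\<psi> (nonneg_inv \<psi> y) = y"
    unfolding nonneg_inv_def using inv_into_into[of y \<psi> "{0..}"] f_inv_into_f[of y \<psi> "{0..}"] by auto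
qed

lemma mulholland_mono:
  "mulholland \<psi> \<Longrightarrow> 0 \<le> x \<Longrightarrow> x \<le> y \<Longrightarrow> \<psi> x \<le> \<psi> y"
  by (auto simp: mulholland_def strict_mono_on_def order_le_less)

lemma mulholland_nonneg: "mulholland \<psi> \<Longrightarrow> 0 \<le> x \<Longrightarrow> 0 \<le> \<psi> x"
  by (auto simp: mulholland_def)

text \<open>On \<open>A\<close> the map is the identity and the cost is \<open>\<psi> 0 = 0\<close>;
  every other point of \<open>P\<close> moves by at most \<open>D\<close>. So the cost integral is
  at most the volume of the moved piece times \<open>\<psi> D\<close>, and a single map bounds the
  infimum from above.\<close>

lemma wasserstein_exchange_less:
  assumes \<psi>: "mulholland \<psi>" and "0 < r"
    and g: "(\<lambda>x. if x \<in> A then x else T x) \<in> transport_maps P Q"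
    and P: "P = A \<union> T -` S" and [measurable]: "T -` S \<in> sets borel"
    and fin: "emeasure lborel (T -` S) < \<infinity>"
    and D: "\<And>x. T x \<in> S \<Longrightarrow> dist x (T x) \<le> D"
    and small: "1 / measure lborel P * (measure lborel (T -` S) * \<psi> D) < \<psi> r"
    and "0 \<le> D"
  shows "wasserstein_metric \<psi> P Q < r"
proof -
  let ?cost = "\<lambda>\<gamma>. 1 / measure lborel P * (LINT x:P|lborel. \<psi> (dist x (\<gamma> x)))"
  let ?g = "\<lambda>x. if x \<in> A then x else T x"
  have cost: "0 \<le> ?cost \<gamma>" for \<gamma>
    unfolding set_lebesgue_integral_def using mulholland_nonneg[OF \<psi>]
    by (intro mult_nonneg_nonneg integral_nonneg) auto
  have "(LINT x:P|lborel. \<psi> (dist x (?g x))) \<le> (\<integral>x. indicator (T -` S) x * \<psi> D \<partial>lborel)"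
    unfolding set_lebesgue_integral_def
  proof (rule integral_mono')
    show "integrable lborel (\<lambda>x. indicator (T -` S) x * \<psi> D)"
      using fin by (intro integrable_mult_left) (simp add: integrable_indicator_iff)
    show "indicator P x *\<^sub>R \<psi> (dist x (?g x)) \<le> indicator (T -` S) x * \<psi> D" for x
      using P D[of x] mulholland_mono[OF \<psi>, of "dist x (T x)" D] \<psi> mulholland_nonneg[OF \<psi> \<open>0 \<le> D\<close>]
      by (auto simp: indicator_def mulholland_def)
    show "0 \<le> indicator (T -` S) x * \<psi> D" for x
      using mulholland_nonneg[OF \<psi> \<open>0 \<le> D\<close>] by (simp add: indicator_def)
  qed
  also have "\<dots> = measure lborel (T -` S) * \<psi> D" by simp
  finally have "?cost ?g < \<psi> r"
    using small by (smt (verit, best) divide_nonneg_nonneg measure_nonneg mult_left_mono)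
  \<comment> \<open>Monotonicity of \<open>\<psi>\<close> itself is used: were the inverse at least
    \<open>r\<close>, the cost would be at least \<open>\<psi> r\<close>.\<close>
  then have "\<not> r \<le> nonneg_inv \<psi> (?cost ?g)"
    using nonneg_inv_mulholland(2)[OF \<psi> cost[of ?g]] \<open>0 < r\<close>
      mulholland_mono[OF \<psi>, of r "nonneg_inv \<psi> (?cost ?g)"] by linarith
  then have "nonneg_inv \<psi> (?cost ?g) < r" by simp
  moreover have "wasserstein_metric \<psi> P Q \<le> nonneg_inv \<psi> (?cost ?g)"
    unfolding wasserstein_metric_def
  proof (rule cINF_lower[OF _ g])
    show "bdd_below ((\<lambda>\<gamma>. nonneg_inv \<psi> (?cost \<gamma>)) ` transport_maps P Q)"
      using nonneg_inv_mulholland(1)[OF \<psi> cost] by (intro bdd_belowI[of _ 0]) auto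
  qed
  ultimately show ?thesis by linarith
qed

section \<open>A Hausdorff-open set defined by a half-space\<close>

text \<open>Distances from the bounded set \<open>P\<close> to one fixed point of \<open>Q\<close>
  are bounded, so the real supremum in \<open>hausdorff1\<close> is a true upper bound.\<close>

lemma infdist_le_hausdorff1:
  assumes "bounded P" "Q \<noteq> {}" "p \<in> P"
  shows "infdist p (closure Q) \<le> hausdorff1 P Q"
proof -
  obtain q where q: "q \<in> Q" using assms by blast
  obtain B where B: "\<And>x. x \<in> P \<Longrightarrow> dist q x \<le> B"
    using assms(1) bounded_any_center[of P q] by blast
  have "infdist x (closure Q) \<le> B" if "x \<in> P" for x
    using infdist_le[of q "closure Q" x] B[OF that] q closure_subset[of Q]
    by (auto simp: dist_commute)
  then show ?thesis
    unfolding hausdorff1_def using assms(3)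
    by (intro cSUP_upper bdd_aboveI2[where M = B]) auto
qed

text \<open>The bound \<open>s\<close> strictly below \<open>a\<close> leaves a gap. Each point of a
  region near \<open>P\<close> lies within \<open>r\<close> of \<open>closure P\<close>, so its
  product with \<open>e\<close> exceeds \<open>s\<close> by at most half the gap.\<close>

lemma openin_hausdorff_halfspace:
  "openin (dist_topology (star_regions :: 'a::euclidean_space set set) hausdorff_metric)
     {Q \<in> star_regions. \<exists>s<a. \<forall>x\<in>Q. x \<bullet> e \<le> s}"
  unfolding openin_dist_topology
proof (intro conjI ballI)
  fix P :: "'a set" assume "P \<in> {Q \<in> star_regions. \<exists>s<a. \<forall>x\<in>Q. x \<bullet> e \<le> s}"
  then obtain s where P: "P \<in> star_regions" and s: "s < a" "\<And>x. x \<in> P \<Longrightarrow> x \<bullet> e \<le> s" by auto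
  have cl: "x \<bullet> e \<le> s" if "x \<in> closure P" for x
  proof -
    have "closure P \<subseteq> {x. x \<bullet> e \<le> s}"
      using s(2) closed_halfspace_le[of e s]
      by (intro closure_minimal) (auto simp: inner_commute)
    then show ?thesis using that by auto
  qed
  define m where "m = (a - s) / 2"
  \<comment> \<open>The \<open>+ 1\<close> keeps the denominator positive: \<open>e\<close> is
    arbitrary here and may be \<open>0\<close>.\<close>
  define r where "r = m / (norm e + 1)"
  have m: "0 < m" using s by (simp add: m_def)
  have r: "0 < r" using m by (simp add: r_def add_nonneg_pos)
  have rm: "r * norm e \<le> m"
  proof -
    have "r * norm e \<le> r * (norm e + 1)" using r by simp
    also have "\<dots> = m" using norm_ge_zero[of e] unfolding r_def by (simp del: norm_ge_zero)
    finally show ?thesis .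
  qed
  have "Q \<in> {Q \<in> star_regions. \<exists>s<a. \<forall>x\<in>Q. x \<bullet> e \<le> s}"
    if Q: "Q \<in> star_regions" "hausdorff_metric P Q < r" for Q
  proof -
    have "x \<bullet> e \<le> s + m" if x: "x \<in> Q" for x
    proof -
      have "infdist x (closure P) < r"
        using infdist_le_hausdorff1[of Q P x] Q P x
        by (auto simp: hausdorff_metric_def star_regions_def region_def)
      moreover have "closure P \<noteq> {}" using P by (auto simp: star_regions_def region_def)
      ultimately obtain q where q: "q \<in> closure P" "dist x q < r"
        using infdist_attains_inf[OF closed_closure, of P x] by metis
      have "(x - q) \<bullet> e \<le> norm (x - q) * norm e" by (rule norm_cauchy_schwarz)
      also have "\<dots> \<le> r * norm e" using q(2) by (intro mult_right_mono) (auto simp: dist_norm)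
      finally show ?thesis using cl[OF q(1)] rm by (simp add: inner_diff_left)
    qed
    moreover have "s + m < a" using s(1) by (simp add: m_def field_simps)
    ultimately show ?thesis using Q(1) by blast
  qed
  then show "\<exists>r>0. \<forall>Q\<in>star_regions. hausdorff_metric P Q < r \<longrightarrow>
      Q \<in> {Q \<in> star_regions. \<exists>s<a. \<forall>x\<in>Q. x \<bullet> e \<le> s}"
    using r by blast
qed auto

text \<open>The \<open>H\<close>-open set of the previous lemma contains \<open>P\<close> but no
  \<open>d\<close>-ball around \<open>P\<close>. With \<open>d\<close> arbitrary, one criterion
  serves the symmetric-difference and all Wasserstein distances.\<close>

lemma not_finer_hausdorff:
  fixes P :: "'a::euclidean_space set"
  assumes P: "P \<in> star_regions" and s: "s < a" "\<And>x. x \<in> P \<Longrightarrow> x \<bullet> e \<le> s"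
    and Q: "\<And>r. 0 < r \<Longrightarrow> \<exists>Q\<in>star_regions. d P Q < r \<and> (\<forall>t<a. \<exists>x\<in>Q. t < x \<bullet> e)"
  shows "\<not> finer_topology (dist_topology star_regions d)
           (dist_topology (star_regions :: 'a set set) hausdorff_metric)"
proof
  define U where "U = {Q \<in> (star_regions :: 'a set set). \<exists>s<a. \<forall>x\<in>Q. x \<bullet> e \<le> s}"
  assume "finer_topology (dist_topology star_regions d)
           (dist_topology (star_regions :: 'a set set) hausdorff_metric)"
  then have "openin (dist_topology star_regions d) U"
    using openin_hausdorff_halfspace unfolding finer_topology_def U_def by blast
  moreover have "P \<in> U" using P s by (auto simp: U_def)
  ultimately obtain r where "r > 0" and r: "\<And>Q. Q \<in> star_regions \<Longrightarrow> d P Q < r \<Longrightarrow> Q \<in> U"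
    unfolding openin_dist_topology by blast
  obtain Q where "Q \<in> star_regions" "d P Q < r" and x: "\<forall>t<a. \<exists>x\<in>Q. t < x \<bullet> e"
    using Q[OF \<open>r > 0\<close>] by blast
  then have "Q \<in> U" using r by blast
  then obtain s where "s < a" "\<forall>x\<in>Q. x \<bullet> e \<le> s" by (auto simp: U_def)
  then show False using x by (meson not_le)
qed

section \<open>The cube and its needles\<close>

lemma cube_star_region: "box (-One) One \<in> (star_regions :: 'a::euclidean_space set set)"
proof -
  have "interior (cbox (-One) One :: 'a set) \<in> star_regions"
  proof (rule interior_star_regions)
    show "t *\<^sub>R x \<in> cbox (-One) One" if "x \<in> cbox (-One) One" "0 \<le> t" "t \<le> 1"
      for t and x :: 'a
      using convexD_alt[OF convex_box(1)[of "-One" "One::'a"] _ that(1), of 0 t] that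
      by (auto simp: mem_box)
  qed (auto simp: mem_box)
  then show ?thesis by simp
qed

lemma norm_le_of_components:
  fixes x :: "'a::euclidean_space"
  assumes "\<And>b. b \<in> Basis \<Longrightarrow> \<bar>x \<bullet> b\<bar> \<le> c"
  shows "norm x \<le> DIM('a) * c"
  using norm_le_l1[of x] sum_bounded_above[of Basis "\<lambda>b. \<bar>x \<bullet> b\<bar>" c] assms
  by fastforce

text \<open>\<open>S\<close> is the open needle beyond the face \<open>x \<bullet> e = 1\<close>,
  its preimage under \<open>T\<close> is the slab cut off, and \<open>A\<close> is the rest of the
  cube. The exchange data are exported along with \<open>Q\<close> so that both distances can be
  estimated from them.\<close>

lemma spike_exchange:
  fixes e :: "'a::euclidean_space"
  assumes dim: "2 \<le> DIM('a)" and e: "e \<in> Basis" and "0 < \<epsilon>"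
  obtains A S :: "'a set" and T :: "'a \<Rightarrow> 'a" and Q :: "'a set" where
    "A \<in> sets borel" "S \<in> sets borel" "T \<in> borel_measurable borel"
    "distr lborel borel T = lborel"
    "A \<inter> T -` S = {}" "A \<inter> S = {}" "box (-One) One = A \<union> T -` S"
    "AE x in lborel. x \<in> Q \<longleftrightarrow> x \<in> A \<union> S"
    "emeasure lborel S < ennreal \<epsilon>"
    "\<forall>x\<in>T -` S. dist x (T x) \<le> 3 * real DIM('a)"
    "Q \<in> star_regions" "\<forall>t<2. \<exists>x\<in>Q. t < x \<bullet> e"
proof -
  \<comment> \<open>The bound \<open>\<epsilon>/4\<close> makes the needle narrower than
    \<open>\<epsilon>\<close>; the bound \<open>1/4\<close> gives
    \<open>2 * \<delta> \<le> 1\<close> and keeps the slab below the level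
    \<open>- \<delta>\<close>.\<close>
  define \<delta> where "\<delta> = min (1/4) (\<epsilon>/4)"
  \<comment> \<open>The thickness of the slab: stretching by \<open>1/\<tau>\<close> along
    \<open>e\<close> balances contracting by \<open>\<delta>\<close> in the remaining
    directions.\<close>
  define \<tau> where "\<tau> = \<delta> ^ (DIM('a) - 1)"
  have \<delta>: "0 < \<delta>" "\<delta> \<le> 1/4" "2 * \<delta> < \<epsilon>" using \<open>0 < \<epsilon>\<close> by (auto simp: \<delta>_def)
  \<comment> \<open>The dimension hypothesis enters here: the exponent is at least \<open>1\<close>,
    so the volume of a needle shrinks with its width.\<close>
  have pow_le: "z ^ (DIM('a) - 1) \<le> z" if "0 < z" "z \<le> 1" for z :: real
    using power_decreasing[of 1 "DIM('a) - 1" z] that dim by simp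
  have \<tau>: "0 < \<tau>" "\<tau> \<le> \<delta>" using \<delta> pow_le[of \<delta>] by (auto simp: \<tau>_def)
  have ee[simp]: "e \<bullet> b = (if b = e then 1 else 0)" if "b \<in> Basis" for b
    using e that by (simp add: inner_Basis)
  have split_Basis: "(\<Prod>b\<in>Basis. f b) = f e * (\<Prod>b\<in>Basis - {e}. f b)" for f :: "'a \<Rightarrow> real"
    using e by (simp add: prod.remove)
  have card: "card (Basis - {e}) = DIM('a) - 1" using e by simp
  define c where "c j = (if j = e then 1/\<tau> else \<delta>)" for j
  \<comment> \<open>The translation takes the face \<open>x \<bullet> e = -1\<close> to
    \<open>x \<bullet> e = 1\<close>, where the needle starts.\<close>
  define T where "T x = (1/\<tau> + 1) *\<^sub>R e + (\<Sum>j\<in>Basis. (c j * (x \<bullet> j)) *\<^sub>R j)" for x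
  have T_comp: "T x \<bullet> b = (if b = e then (x \<bullet> b + 1)/\<tau> + 1 else \<delta> * (x \<bullet> b))" if "b \<in> Basis" for x b
    using that e by (simp add: T_def inner_add_left inner_sum_left_Basis c_def add_divide_distrib)
  define S where "S = box ((1 + \<delta>) *\<^sub>R e - \<delta> *\<^sub>R One) ((2 - \<delta>) *\<^sub>R e + \<delta> *\<^sub>R One)"
  define A where "A = box (-One) One - T -` S"
  define C1 where "C1 = cbox (\<tau> *\<^sub>R e - One) One"
  \<comment> \<open>The needle is prolonged backwards, inside \<open>C1\<close>, so that
    \<open>0\<close> is interior to it. Then \<open>C1\<close> and \<open>C2\<close> are convex sets
    containing \<open>0\<close>, and their union is star-shaped.\<close>
  define C2 where "C2 = cbox (- \<delta> *\<^sub>R One) ((2 - \<delta>) *\<^sub>R e + \<delta> *\<^sub>R One)"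
  define Q where "Q = interior (C1 \<union> C2)"
  have S_iff: "x \<in> S \<longleftrightarrow> 1 < x \<bullet> e \<and> x \<bullet> e < 2 \<and> (\<forall>b\<in>Basis - {e}. -\<delta> < x \<bullet> b \<and> x \<bullet> b < \<delta>)" for x
    using e by (auto simp: S_def mem_box inner_diff_left inner_add_left)
  have C1_iff: "x \<in> C1 \<longleftrightarrow> \<tau> - 1 \<le> x \<bullet> e \<and> x \<bullet> e \<le> 1 \<and> (\<forall>b\<in>Basis - {e}. -1 \<le> x \<bullet> b \<and> x \<bullet> b \<le> 1)" for x
    using e by (auto simp: C1_def mem_box inner_diff_left inner_add_left)
  have C1_int: "x \<in> interior C1 \<longleftrightarrow> \<tau> - 1 < x \<bullet> e \<and> x \<bullet> e < 1 \<and> (\<forall>b\<in>Basis - {e}. -1 < x \<bullet> b \<and> x \<bullet> b < 1)" for x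
    using e by (auto simp: C1_def mem_box inner_diff_left inner_add_left)
  have C2_iff: "x \<in> C2 \<longleftrightarrow> - \<delta> \<le> x \<bullet> e \<and> x \<bullet> e \<le> 2 \<and> (\<forall>b\<in>Basis - {e}. -\<delta> \<le> x \<bullet> b \<and> x \<bullet> b \<le> \<delta>)" for x
    using e by (auto simp: C2_def mem_box inner_diff_left inner_add_left)
  have C2_int: "x \<in> interior C2 \<longleftrightarrow> - \<delta> < x \<bullet> e \<and> x \<bullet> e < 2 \<and> (\<forall>b\<in>Basis - {e}. -\<delta> < x \<bullet> b \<and> x \<bullet> b < \<delta>)" for x
    using e by (auto simp: C2_def mem_box inner_diff_left inner_add_left)
  have P_iff: "x \<in> box (-One) One \<longleftrightarrow> -1 < x \<bullet> e \<and> x \<bullet> e < 1 \<and> (\<forall>b\<in>Basis - {e}. -1 < x \<bullet> b \<and> x \<bullet> b < 1)" for x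
    using e by (auto simp: mem_box)
  have TS_iff: "T x \<in> S \<longleftrightarrow> -1 < x \<bullet> e \<and> x \<bullet> e < \<tau> - 1 \<and> (\<forall>b\<in>Basis - {e}. -1 < x \<bullet> b \<and> x \<bullet> b < 1)" for x
  proof -
    have "-\<delta> < \<delta> * y \<longleftrightarrow> -1 < y" "\<delta> * y < \<delta> \<longleftrightarrow> y < 1" for y
      using \<delta>(1) mult_less_cancel_left_pos[of \<delta> "-1" y] mult_less_cancel_left_pos[of \<delta> y 1] by auto
    moreover have "1 < (y + 1) / \<tau> + 1 \<longleftrightarrow> -1 < y" "(y + 1) / \<tau> + 1 < 2 \<longleftrightarrow> y < \<tau> - 1" for y
      using \<tau>(1) by (auto simp: field_simps)
    ultimately show ?thesis
      using e by (simp add: S_iff T_comp)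
  qed
  have T_meas: "T \<in> borel_measurable borel"
    unfolding T_def by measurable
  show thesis
  proof (rule that[of A S T Q])
    show S: "S \<in> sets borel" by (simp add: S_def)
    show "T \<in> borel_measurable borel" by (fact T_meas)
    then show "A \<in> sets borel"
      using measurable_sets[OF T_meas S] by (simp add: A_def)
    show "distr lborel borel T = lborel"
      unfolding T_def
      by (rule distr_diagonal_affine)
        (use \<delta>(1) card in \<open>simp add: split_Basis c_def \<tau>_def abs_divide\<close>)
    show "A \<inter> T -` S = {}" by (auto simp: A_def)
    show "A \<inter> S = {}" by (auto simp: A_def P_iff S_iff)
    have "T -` S \<subseteq> box (-One) One"
      using \<tau> \<delta> by (auto simp: P_iff TS_iff)
    then show "box (-One) One = A \<union> T -` S" by (auto simp: A_def)
    have C1_fr: "x \<in> A \<longleftrightarrow> x \<in> C1" if "x \<notin> frontier C1" for x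
    proof
      assume "x \<in> A"
      then have "x \<in> box (-One) One" "\<not> T x \<in> S" by (auto simp: A_def)
      then have "\<not> x \<bullet> e < \<tau> - 1" "x \<bullet> e < 1" "\<forall>b\<in>Basis - {e}. -1 < x \<bullet> b \<and> x \<bullet> b < 1"
        unfolding P_iff TS_iff by blast+
      then show "x \<in> C1" by (simp add: C1_iff less_imp_le)
    next
      assume "x \<in> C1"
      then have "x \<in> interior C1" using that closure_subset[of C1] by (auto simp: frontier_def)
      then show "x \<in> A" using \<tau> by (auto simp: A_def P_iff TS_iff C1_int)
    qed
    \<comment> \<open>A point of \<open>C2\<close> satisfies all constraints of \<open>C1\<close>
      except possibly \<open>x \<bullet> e \<le> 1\<close>, because
      \<open>\<tau> - 1 < - \<delta>\<close> and \<open>\<delta> < 1\<close>. Outside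
      \<open>C1\<close> only the part beyond the face is left.\<close>
    have C2_fr: "x \<in> S \<longleftrightarrow> x \<in> C2" if "x \<notin> frontier C2" "x \<notin> C1" for x
    proof
      assume "x \<in> S" then show "x \<in> C2"
        using \<delta> by (auto simp: S_iff C2_iff less_imp_le)
    next
      assume "x \<in> C2"
      then have "x \<in> interior C2" using that closure_subset[of C2] by (auto simp: frontier_def)
      moreover have "-1 \<le> x \<bullet> b \<and> x \<bullet> b \<le> 1" if "b \<in> Basis - {e}" for b
        using \<open>x \<in> C2\<close> that \<delta>(2) unfolding C2_iff by force
      ultimately show "x \<in> S" using \<open>x \<notin> C1\<close> \<tau> \<delta> unfolding C2_int S_iff C1_iff by force
    qed
    have SC: "S \<subseteq> C2" using \<delta> by (auto simp: S_iff C2_iff less_imp_le)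
    \<comment> \<open>The frontier of a union lies in the union of the frontiers, so passing to the
      interior changes nothing off two null sets.\<close>
    have C12: "x \<in> C1 \<union> C2 \<longleftrightarrow> x \<in> Q" if "x \<notin> frontier C1" "x \<notin> frontier C2" for x
      using that frontier_Un_subset[of C1 C2] closure_subset[of "C1 \<union> C2"] interior_subset[of "C1 \<union> C2"]
      unfolding Q_def frontier_def by blast
    have "AE x in lborel. x \<notin> frontier C1" "AE x in lborel. x \<notin> frontier C2"
      by (auto simp: C1_def C2_def intro!: AE_not_in_frontier_convex)
    then show "AE x in lborel. x \<in> Q \<longleftrightarrow> x \<in> A \<union> S"
      by eventually_elim (use C1_fr C2_fr C12 SC in blast)
    have "emeasure lborel S = ennreal ((2 * \<delta>) ^ (DIM('a) - 1))"
      unfolding S_def using \<delta> e card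
      by (subst emeasure_lborel_box)
        (auto simp: inner_diff_left inner_add_left split_Basis)
    also have "\<dots> \<le> ennreal (2 * \<delta>)" using pow_le[of "2 * \<delta>"] \<delta> by (intro ennreal_leI) auto
    also have "\<dots> < ennreal \<epsilon>" using \<delta> by (intro ennreal_lessI) auto
    finally show "emeasure lborel S < ennreal \<epsilon>" .
    show "\<forall>x\<in>T -` S. dist x (T x) \<le> 3 * real DIM('a)"
    proof
      fix x assume "x \<in> T -` S"
      then have x: "T x \<in> S" by simp
      \<comment> \<open>Along \<open>e\<close> the point moves from \<open>(-1, \<tau> - 1)\<close>
        into \<open>(1, 2)\<close>, hence by less than \<open>3\<close>; any other coordinate
        changes by less than \<open>1 + \<delta>\<close>.\<close>
      have "\<bar>(x - T x) \<bullet> b\<bar> \<le> 3" if "b \<in> Basis" for b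
      proof (cases "b = e")
        case True
        then show ?thesis using x \<tau> \<delta> TS_iff[of x] S_iff[of "T x"] by (auto simp: inner_diff_left)
      next
        case False
        then have "-1 < x \<bullet> b" "x \<bullet> b < 1" "-\<delta> < T x \<bullet> b" "T x \<bullet> b < \<delta>"
          using x that TS_iff[of x] S_iff[of "T x"] by auto
        then show ?thesis using \<delta> by (auto simp: inner_diff_left)
      qed
      then show "dist x (T x) \<le> 3 * real DIM('a)"
        using norm_le_of_components[of "x - T x" 3] by (simp add: dist_norm)
    qed
    show "Q \<in> star_regions"
      unfolding Q_def
    proof (rule interior_star_regions)
      show "closed (C1 \<union> C2)" "bounded (C1 \<union> C2)" by (auto simp: C1_def C2_def)
      have "0 \<in> interior C2" using \<delta> by (auto simp: C2_int)
      then show "0 \<in> interior (C1 \<union> C2)" by (meson Un_upper2 interior_mono subsetD)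
      have 0: "0 \<in> C1" "0 \<in> C2" using \<delta> \<tau> by (auto simp: C1_iff C2_iff)
      have "convex C1" "convex C2" by (auto simp: C1_def C2_def)
      then show "t *\<^sub>R x \<in> C1 \<union> C2" if "x \<in> C1 \<union> C2" "0 \<le> t" "t \<le> 1" for x t
        using that convexD_alt[of _ 0 x t] 0 by auto
    qed
    show "\<forall>t<2. \<exists>x\<in>Q. t < x \<bullet> e"
    proof (intro allI impI)
      fix t :: real assume t: "t < 2"
      \<comment> \<open>The midpoint of \<open>t\<close> and \<open>2\<close> on the axis, replaced
        by \<open>0\<close> when it is negative so as to stay in the needle.\<close>
      let ?x = "max 0 ((t + 2) / 2) *\<^sub>R e"
      have "?x \<in> interior C2" using t \<delta> e by (auto simp: C2_int)
      then have "?x \<in> Q" unfolding Q_def by (meson Un_upper2 interior_mono subsetD)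
      moreover have "t < ?x \<bullet> e" using t e by (auto simp: max_def)
      ultimately show "\<exists>x\<in>Q. t < x \<bullet> e" by blast
    qed
  qed
qed

section \<open>Needled cubes near the cube in both distances\<close>

text \<open>Up to a null set the symmetric difference lies in the union of slab and needle, which
  have equal volume, below \<open>r/2\<close> each.\<close>

lemma exists_small_symdiff:
  fixes e :: "'a::euclidean_space"
  assumes dim: "2 \<le> DIM('a)" and e: "e \<in> Basis" and "0 < r"
  shows "\<exists>Q\<in>star_regions. symdiff_metric (box (-One) One) Q < r \<and> (\<forall>t<2. \<exists>x\<in>Q. t < x \<bullet> e)"
proof -
  from \<open>0 < r\<close> have "0 < r/2" by simp
  obtain A S :: "'a set" and T :: "'a \<Rightarrow> 'a" and Q :: "'a set" where
    A: "A \<in> sets borel" and S: "S \<in> sets borel" and T: "T \<in> borel_measurable borel"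
    and dT: "distr lborel borel T = lborel"
    and disj: "A \<inter> T -` S = {}" "A \<inter> S = {}" and P: "box (-One) One = A \<union> T -` S"
    and AE: "AE x in lborel. x \<in> Q \<longleftrightarrow> x \<in> A \<union> S" and small: "emeasure lborel S < ennreal (r/2)"
    and "\<forall>x\<in>T -` S. dist x (T x) \<le> 3 * real DIM('a)"
    and Q: "Q \<in> star_regions" "\<forall>t<2. \<exists>x\<in>Q. t < x \<bullet> e"
    by (rule spike_exchange[OF dim e \<open>0 < r/2\<close>])
  have TS: "T -` S \<in> sets borel" using measurable_sets[OF T S] by simp
  have vT: "emeasure lborel (T -` S) = emeasure lborel S"
    using emeasure_vimage_preserving[OF T dT S] .
  have "Q \<in> sets borel" using Q by (auto simp: star_regions_def region_def)
  have "emeasure lborel ((box (-One) One - Q) \<union> (Q - box (-One) One)) \<le> emeasure lborel (T -` S \<union> S)"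
    using AE TS S P by (intro emeasure_mono_AE) auto
  also have "\<dots> \<le> emeasure lborel (T -` S) + emeasure lborel S"
    using TS S by (intro emeasure_subadditive) auto
  also have "\<dots> < ennreal (r/2) + ennreal (r/2)"
    using small vT by (simp add: add_strict_mono)
  also have "\<dots> = ennreal r" using \<open>0 < r\<close> by (simp flip: ennreal_plus)
  finally have "symdiff_metric (box (-One) One) Q < r"
    unfolding symdiff_metric_def by (rule measure_less_if_emeasure_less)
  then show ?thesis using Q by blast
qed

lemma exists_small_wasserstein:
  fixes e :: "'a::euclidean_space"
  assumes dim: "2 \<le> DIM('a)" and e: "e \<in> Basis" and "0 < r" and \<psi>: "mulholland \<psi>"
  shows "\<exists>Q\<in>star_regions. wasserstein_metric \<psi> (box (-One) One) Q < r \<and> (\<forall>t<2. \<exists>x\<in>Q. t < x \<bullet> e)"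
proof -
  let ?D = "3 * real DIM('a)" and ?v = "measure lborel (box (-One) (One::'a))"
  have pos: "0 < \<psi> z" if "0 < z" for z
    using strict_mono_onD[of "{0..}" \<psi> 0 z] \<psi> that by (simp add: mulholland_def)
  have v: "0 < ?v" by (auto simp: inner_add_left intro!: prod_pos)
  \<comment> \<open>Chosen so that moving a piece of volume \<open>\<epsilon>\<close> by
    \<open>?D\<close> has normalised cost exactly \<open>\<psi> r\<close>.\<close>
  define \<epsilon> where "\<epsilon> = ?v * \<psi> r / \<psi> ?D"
  have "0 < \<epsilon>" using v pos \<open>0 < r\<close> by (simp add: \<epsilon>_def)
  obtain A S :: "'a set" and T :: "'a \<Rightarrow> 'a" and Q :: "'a set" where
    A: "A \<in> sets borel" and S: "S \<in> sets borel" and T: "T \<in> borel_measurable borel"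
    and dT: "distr lborel borel T = lborel"
    and disj: "A \<inter> T -` S = {}" "A \<inter> S = {}" and P: "box (-One) One = A \<union> T -` S"
    and AE: "AE x in lborel. x \<in> Q \<longleftrightarrow> x \<in> A \<union> S" and small: "emeasure lborel S < ennreal \<epsilon>"
    and D: "\<forall>x\<in>T -` S. dist x (T x) \<le> ?D"
    and Q: "Q \<in> star_regions" "\<forall>t<2. \<exists>x\<in>Q. t < x \<bullet> e"
    by (rule spike_exchange[OF dim e \<open>0 < \<epsilon>\<close>])
  have TS: "T -` S \<in> sets borel" using measurable_sets[OF T S] by simp
  have vT: "emeasure lborel (T -` S) = emeasure lborel S"
    using emeasure_vimage_preserving[OF T dT S] .
  have Qb: "Q \<in> sets borel" using Q by (auto simp: star_regions_def region_def)
  have fin: "emeasure lborel (T -` S) < \<infinity>"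
    using small vT ennreal_less_top order.strict_trans by (metis infinity_ennreal_def)
  have "measure lborel (T -` S) < \<epsilon>"
    using small vT by (intro measure_less_if_emeasure_less) simp
  then have "1 / ?v * (measure lborel (T -` S) * \<psi> ?D) < \<psi> r"
    using v pos[of ?D] by (simp add: \<epsilon>_def field_simps)
  then have "wasserstein_metric \<psi> (box (-One) One) Q < r"
    using exchange_in_transport_maps[OF A S Qb T dT disj P AE] \<psi> \<open>0 < r\<close> P TS fin D
    by (intro wasserstein_exchange_less[where A = A and T = T and S = S and D = ?D]) auto
  then show ?thesis using Q by blast
qed

theorem theorem16:
  assumes "2 \<le> DIM('a::euclidean_space)"
  shows "\<not> finer_topology
            (dist_topology (star_regions :: 'a set set) symdiff_metric)
            (dist_topology (star_regions :: 'a set set) hausdorff_metric)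
       \<and> (\<forall>\<psi>. mulholland \<psi> \<longrightarrow>
            \<not> finer_topology
                (dist_topology (star_regions :: 'a set set) (wasserstein_metric \<psi>))
                (dist_topology (star_regions :: 'a set set) hausdorff_metric))"
proof -
  obtain e :: 'a where e: "e \<in> Basis" using nonempty_Basis by blast
  \<comment> \<open>The criterion is applied with the levels \<open>1\<close>, which bounds the
    cube, and \<open>2\<close>, which the needles approach.\<close>
  have le: "x \<bullet> e \<le> 1" if "x \<in> box (-One) One" for x
    using that e by (auto simp: mem_box less_imp_le)
  have lt: "(1::real) < 2" by simp
  show ?thesis
    using not_finer_hausdorff[OF cube_star_region lt le]
      exists_small_symdiff[OF assms e] exists_small_wasserstein[OF assms e] by blast
qed

end
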